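(* Let $D\subset\mathbb{R}^d$ be a design with $n$ distinct points and let $w\in\mathbb{R}^d_{>0}$ be a weight vector. Then there is at least one vertex $\alpha^*$ of the state polytope $S(D)$ which minimises $A(w,L)$ over all identifiable staircase models $\mathcal{L}_s(D)$, that is, $$\frac{1}{n}\,w^T\alpha^* \;=\; A(w,L^* )\;=\;\min_{L\in\mathcal{L}_s(D)}A(w,L)$$ for all $L^*$ with $\overline{\alpha}_{L^*}=\alpha^*$. Moreover, given any vertex $\overline{\alpha}_{\overline{L}}$ of $S(D)$ (with $\overline L\in\mathcal L_a(D)$), there is at least one $w^*\in\mathbb{R}^d_{>0}$ such that this vertex (model) minimises the aberration for $w^*$, that is, $A(w^*,\overline{L})=\min_{L\in\mathcal{L}_a(D)}A(w^*,L)$.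
   Context: A design $D\subset\mathbb{R}^d$ is a finite set of $n=|D|$ points. A monomial is $x^\alpha=x_1^{\alpha_1}\cdots x_d^{\alpha_d}$ with $\alpha\in\mathbb{Z}_{\ge0}^d$. A model basis is a finite set $L\subset\mathbb{Z}^d_{\ge 0}$ of exponents; it is identifiable by $D$ if $|L|=n$ and the matrix $[x^\alpha]_{x\in D,\alpha\in L}$ is invertible. $L$ is a staircase if $\alpha\in L$ and $\beta\le\alpha$ componentwise imply $\beta\in L$. $\mathcal{L}_s(D)$ denotes the set of all staircases identifiable by $D$. For a weight vector $w$ and a model basis $L$ with $|L|=n$, the (weighted linear) aberration is $A(w,L)=\frac{1}{n}\sum_{\alpha\in L}\sum_{i=1}^d w_i\alpha_i=\frac1n w^T\overline{\alpha}_L$, where $\overline{\alpha}_L=\sum_{\alpha\in L}\alpha$. The design ideal $I(D)$ is the ideal of all real polynomials vanishing on $D$. For a term ordering $\succ$ on monomials, $L(D,\succ)$ is the set of exponents of monomials not divisible by any leading term (w.r.t. $\succ$) of an element of $I(D)$ (equivalently of a Gröbner basis of $I(D)$); it is an identifiable staircase. The algebraic fan is $\mathcal{L}_a(D)=\{L(D,\succ):\succ \text{ a term ordering}\}$, and the state polytope is $S(D)=\mathrm{conv}\{\overline{\alpha}_L: L\in\mathcal{L}_a(D)\}$. *)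

theory Defs
  imports "HOL-Analysis.Analysis"
begin

type_synonym 'd expo = "'d \<Rightarrow> nat"

definition monom :: "real^'d \<Rightarrow> 'd expo \<Rightarrow> real" where
  "monom x \<alpha> = (\<Prod>i\<in>UNIV. (x $ i) ^ (\<alpha> i))"

definition poly_supp :: "('d expo \<Rightarrow> real) \<Rightarrow> 'd expo set" where
  "poly_supp c = {\<alpha>. c \<alpha> \<noteq> 0}"

definition is_mpoly :: "('d expo \<Rightarrow> real) \<Rightarrow> bool" where
  "is_mpoly c \<longleftrightarrow> finite (poly_supp c)"

definition mpoly_eval :: "('d expo \<Rightarrow> real) \<Rightarrow> real^'d \<Rightarrow> real" where
  "mpoly_eval c x = (\<Sum>\<alpha>\<in>poly_supp c. c \<alpha> * monom x \<alpha>)"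

definition design_ideal :: "(real^'d) set \<Rightarrow> ('d expo \<Rightarrow> real) set" where
  "design_ideal D = {c. is_mpoly c \<and> (\<forall>x\<in>D. mpoly_eval c x = 0)}"

text \<open>Identifiability: |L| = n and the design matrix [x^alpha] (rows x in D,
 columns alpha in L) is invertible, i.e. has a two-sided inverse.\<close>
definition identifiable :: "(real^'d) set \<Rightarrow> 'd expo set \<Rightarrow> bool" where
  "identifiable D L \<longleftrightarrow> finite L \<and> card L = card D \<and>
     (\<exists>B :: 'd expo \<Rightarrow> real^'d \<Rightarrow> real.
        (\<forall>x\<in>D. \<forall>y\<in>D. (\<Sum>\<alpha>\<in>L. monom x \<alpha> * B \<alpha> y) = (if x = y then 1 else 0)) \<and>
        (\<forall>\<alpha>\<in>L. \<forall>\<beta>\<in>L. (\<Sum>x\<in>D. B \<alpha> x * monom x \<beta>) = (if \<alpha> = \<beta> then 1 else 0)))"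

definition staircase :: "'d expo set \<Rightarrow> bool" where
  "staircase L \<longleftrightarrow> (\<forall>\<alpha>\<in>L. \<forall>\<beta>. (\<forall>i. \<beta> i \<le> \<alpha> i) \<longrightarrow> \<beta> \<in> L)"

definition ident_staircases :: "(real^'d) set \<Rightarrow> 'd expo set set" where
  "ident_staircases D = {L. staircase L \<and> identifiable D L}"

definition term_order :: "('d expo \<Rightarrow> 'd expo \<Rightarrow> bool) \<Rightarrow> bool" where
  "term_order ord \<longleftrightarrow>
     (\<forall>\<alpha>. \<not> ord \<alpha> \<alpha>) \<and>
     (\<forall>\<alpha> \<beta> \<gamma>. ord \<alpha> \<beta> \<longrightarrow> ord \<beta> \<gamma> \<longrightarrow> ord \<alpha> \<gamma>) \<and>
     (\<forall>\<alpha> \<beta>. \<alpha> \<noteq> \<beta> \<longrightarrow> ord \<alpha> \<beta> \<or> ord \<beta> \<alpha>) \<and>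
     (\<forall>\<alpha>. \<alpha> \<noteq> (\<lambda>_. 0) \<longrightarrow> ord (\<lambda>_. 0) \<alpha>) \<and>
     (\<forall>\<alpha> \<beta> \<gamma>. ord \<alpha> \<beta> \<longrightarrow> ord (\<lambda>i. \<alpha> i + \<gamma> i) (\<lambda>i. \<beta> i + \<gamma> i))"

definition lead_exp :: "('d expo \<Rightarrow> 'd expo \<Rightarrow> bool) \<Rightarrow> ('d expo \<Rightarrow> real) \<Rightarrow> 'd expo" where
  "lead_exp ord c = (THE \<alpha>. \<alpha> \<in> poly_supp c \<and> (\<forall>\<beta>\<in>poly_supp c. \<beta> \<noteq> \<alpha> \<longrightarrow> ord \<beta> \<alpha>))"

definition std_basis :: "(real^'d) set \<Rightarrow> ('d expo \<Rightarrow> 'd expo \<Rightarrow> bool) \<Rightarrow> 'd expo set" where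
  "std_basis D ord = {\<alpha>. \<forall>c\<in>design_ideal D. c \<noteq> (\<lambda>_. 0) \<longrightarrow>
       \<not> (\<forall>i. lead_exp ord c i \<le> \<alpha> i)}"

definition algebraic_fan :: "(real^'d) set \<Rightarrow> 'd expo set set" where
  "algebraic_fan D = {std_basis D ord | ord. term_order ord}"

definition alpha_bar :: "'d expo set \<Rightarrow> real^'d" where
  "alpha_bar L = (\<chi> i. \<Sum>\<alpha>\<in>L. real (\<alpha> i))"

definition aberration :: "real^'d \<Rightarrow> 'd expo set \<Rightarrow> real" where
  "aberration w L = (1 / real (card L)) * (\<Sum>\<alpha>\<in>L. \<Sum>i\<in>UNIV. w $ i * real (\<alpha> i))"

definition state_polytope :: "(real^'d) set \<Rightarrow> (real^'d) set" where
  "state_polytope D = convex hull (alpha_bar ` algebraic_fan D)"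

end

theory Submission
  imports Defs
begin

text \<open>
  For a term ordering \<open>ord\<close>, any identifiable model \<open>M\<close> can be transformed into \<open>std_basis D ord\<close> by
  exchanging one exponent at a time for an \<open>ord\<close>-smaller one: the normal form of an exponent
  \<open>\<beta> \<in> M\<close> outside the standard basis involves only smaller standard exponents, and one of them is
  not in the span of the rest of \<open>M\<close>. Hence the standard basis minimises the sum of every weight that
  is monotone along \<open>ord\<close>. Applied to an ordering that refines the weight \<open>w\<close>, this shows that the
  minimum of the aberration over all identifiable staircases is attained in the state polytope, hence
  at one of its vertices. Conversely, only finitely many exponents occur in identifiable staircases,
  and on a finite set every term ordering is represented by a positive weight vector, which
  Fourier-Motzkin elimination provides.
\<close>

section \<open>Spans of monomials on a design\<close>

text \<open>The span is taken among functions on \<open>D\<close>, so equality is asked only at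
  design points. \<open>S\<close> may be infinite, because the standard basis is used before its
  finiteness is known.\<close>

definition in_span :: "(real^'d) set \<Rightarrow> 'd expo set \<Rightarrow> (real^'d \<Rightarrow> real) \<Rightarrow> bool" where
  "in_span D S f \<longleftrightarrow> (\<exists>c. is_mpoly c \<and> poly_supp c \<subseteq> S \<and> (\<forall>x\<in>D. f x = mpoly_eval c x))"

definition monom_indep :: "(real^'d) set \<Rightarrow> 'd expo set \<Rightarrow> bool" where
  "monom_indep D L \<longleftrightarrow> (\<forall>\<alpha>\<in>L. \<not> in_span D (L - {\<alpha>}) (\<lambda>x. monom x \<alpha>))"

lemma mpoly_eval_superset:
  assumes "finite A" "poly_supp c \<subseteq> A"
  shows "mpoly_eval c x = (\<Sum>\<alpha>\<in>A. c \<alpha> * monom x \<alpha>)"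
  unfolding mpoly_eval_def
  by (rule sum.mono_neutral_left) (use assms in \<open>auto simp: poly_supp_def\<close>)

lemma monom_add: "monom x (\<lambda>i. \<alpha> i + \<beta> i) = monom x \<alpha> * monom x \<beta>"
  by (simp add: monom_def power_add prod.distrib)

lemma monom_zero [simp]: "monom x (\<lambda>_. 0) = 1"
  by (simp add: monom_def)

lemma monom_unit: "monom x (\<lambda>j. if j = i then 1 else 0) = x $ i"
proof -
  have "monom x (\<lambda>j. if j = i then 1 else 0) = (\<Prod>j\<in>UNIV. if j = i then x $ j else 1)"
    unfolding monom_def by (rule prod.cong) auto
  then show ?thesis by simp
qed

lemma in_span_mono: "in_span D S f \<Longrightarrow> S \<subseteq> T \<Longrightarrow> in_span D T f"
  unfolding in_span_def by blast

lemma in_span_cong: "in_span D S f \<Longrightarrow> (\<And>x. x \<in> D \<Longrightarrow> f x = g x) \<Longrightarrow> in_span D S g"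
  unfolding in_span_def by metis

lemma in_span_finite_sum:
  assumes "finite A" "A \<subseteq> S" "\<And>x. x \<in> D \<Longrightarrow> f x = (\<Sum>\<alpha>\<in>A. c \<alpha> * monom x \<alpha>)"
  shows "in_span D S f"
proof -
  define c' where "c' = (\<lambda>\<alpha>. if \<alpha> \<in> A then c \<alpha> else 0)"
  have supp: "poly_supp c' \<subseteq> A"
    by (auto simp: c'_def poly_supp_def)
  have "mpoly_eval c' x = (\<Sum>\<alpha>\<in>A. c \<alpha> * monom x \<alpha>)" for x
    unfolding mpoly_eval_superset[OF assms(1) supp] by (rule sum.cong) (auto simp: c'_def)
  moreover have "is_mpoly c'"
    unfolding is_mpoly_def using supp assms(1) by (rule finite_subset)
  ultimately show ?thesis
    unfolding in_span_def using supp assms by (intro exI[of _ c']) auto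
qed

lemma in_span_zero: "in_span D S (\<lambda>_. 0)"
  by (rule in_span_finite_sum[of "{}"]) auto

lemma in_span_monom: "\<alpha> \<in> S \<Longrightarrow> in_span D S (\<lambda>x. monom x \<alpha>)"
  by (rule in_span_finite_sum[of "{\<alpha>}" _ _ _ "\<lambda>_. 1"]) auto

lemma in_span_add:
  assumes "in_span D S f" "in_span D S g"
  shows "in_span D S (\<lambda>x. f x + g x)"
proof -
  obtain c where c: "finite (poly_supp c)" "poly_supp c \<subseteq> S" "\<forall>x\<in>D. f x = mpoly_eval c x"
    using assms(1) unfolding in_span_def is_mpoly_def by blast
  obtain e where e: "finite (poly_supp e)" "poly_supp e \<subseteq> S" "\<forall>x\<in>D. g x = mpoly_eval e x"
    using assms(2) unfolding in_span_def is_mpoly_def by blast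
  have fin: "finite (poly_supp c \<union> poly_supp e)"
    using c e by blast
  show ?thesis
  proof (rule in_span_finite_sum[OF fin])
    fix x assume "x \<in> D"
    then show "f x + g x = (\<Sum>\<alpha>\<in>poly_supp c \<union> poly_supp e. (c \<alpha> + e \<alpha>) * monom x \<alpha>)"
      using c(3) e(3) mpoly_eval_superset[OF fin, of c x] mpoly_eval_superset[OF fin, of e x]
      by (simp add: distrib_right sum.distrib)
  qed (use c e in auto)
qed

lemma in_span_scale:
  assumes "in_span D S f"
  shows "in_span D S (\<lambda>x. a * f x)"
proof -
  obtain c where c: "finite (poly_supp c)" "poly_supp c \<subseteq> S" "\<forall>x\<in>D. f x = mpoly_eval c x"
    using assms(1) unfolding in_span_def is_mpoly_def by blast
  show ?thesis
    by (rule in_span_finite_sum[OF c(1,2), of _ _ "\<lambda>\<alpha>. a * c \<alpha>"])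
      (use c in \<open>auto simp: mpoly_eval_def sum_distrib_left mult.assoc\<close>)
qed

lemma in_span_sum:
  assumes "\<And>k. k \<in> K \<Longrightarrow> in_span D S (f k)"
  shows "in_span D S (\<lambda>x. \<Sum>k\<in>K. f k x)"
  using assms
  by (induction K rule: infinite_finite_induct) (auto intro: in_span_zero in_span_add)

lemma in_span_trans:
  assumes "in_span D S f" "\<And>\<alpha>. \<alpha> \<in> S \<Longrightarrow> in_span D T (\<lambda>x. monom x \<alpha>)"
  shows "in_span D T f"
proof -
  obtain c where c: "poly_supp c \<subseteq> S" "\<forall>x\<in>D. f x = mpoly_eval c x"
    using assms(1) unfolding in_span_def by blast
  have "in_span D T (\<lambda>x. \<Sum>\<alpha>\<in>poly_supp c. c \<alpha> * monom x \<alpha>)"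
    by (intro in_span_sum in_span_scale assms(2)) (use c in auto)
  then show ?thesis
    by (rule in_span_cong) (use c in \<open>auto simp: mpoly_eval_def\<close>)
qed

lemma in_span_mult_monom:
  assumes "in_span D UNIV f"
  shows "in_span D UNIV (\<lambda>x. f x * monom x \<delta>)"
proof -
  obtain c where c: "\<forall>x\<in>D. f x = mpoly_eval c x"
    using assms(1) unfolding in_span_def by blast
  have "in_span D UNIV (\<lambda>x. \<Sum>\<alpha>\<in>poly_supp c. c \<alpha> * monom x (\<lambda>i. \<alpha> i + \<delta> i))"
    by (intro in_span_sum in_span_scale in_span_monom) simp
  then show ?thesis
    by (rule in_span_cong)
      (use c in \<open>auto simp: mpoly_eval_def monom_add sum_distrib_left sum_distrib_right mult_ac\<close>)
qed

lemma in_span_insertE: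
  assumes "in_span D (insert \<beta> S) f"
  obtains a where "in_span D S (\<lambda>x. f x - a * monom x \<beta>)"
proof -
  obtain c where c: "finite (poly_supp c)" "poly_supp c \<subseteq> insert \<beta> S" "\<forall>x\<in>D. f x = mpoly_eval c x"
    using assms(1) unfolding in_span_def is_mpoly_def by blast
  have "in_span D S (\<lambda>x. f x - c \<beta> * monom x \<beta>)"
  proof (rule in_span_finite_sum[of "poly_supp c - {\<beta>}"])
    fix x assume "x \<in> D"
    have "mpoly_eval c x = (\<Sum>\<alpha>\<in>insert \<beta> (poly_supp c). c \<alpha> * monom x \<alpha>)"
      by (rule mpoly_eval_superset) (use c in auto)
    then show "f x - c \<beta> * monom x \<beta> = (\<Sum>\<alpha>\<in>poly_supp c - {\<beta>}. c \<alpha> * monom x \<alpha>)"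
      using c(3) \<open>x \<in> D\<close> sum.insert_remove[OF c(1), of "\<lambda>\<alpha>. c \<alpha> * monom x \<alpha>" \<beta>] by simp
  qed (use c in auto)
  then show thesis by (rule that)
qed

text \<open>Steinitz exchange: \<beta> must occur in the expansion of \<alpha>, otherwise
  \<open>S\<close> alone would span \<alpha>; the relation is then solved for \<beta>.\<close>

lemma in_span_exchange:
  assumes "in_span D (insert \<beta> S) (\<lambda>x. monom x \<alpha>)" "\<not> in_span D S (\<lambda>x. monom x \<alpha>)"
  shows "in_span D (insert \<alpha> S) (\<lambda>x. monom x \<beta>)"
proof -
  obtain a where a: "in_span D S (\<lambda>x. monom x \<alpha> - a * monom x \<beta>)"
    using assms(1) by (rule in_span_insertE)
  have "a \<noteq> 0"
    using a assms(2) by auto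
  have "in_span D (insert \<alpha> S) (\<lambda>x. (1/a) * monom x \<alpha> + (-1/a) * (monom x \<alpha> - a * monom x \<beta>))"
    by (intro in_span_add in_span_scale in_span_monom in_span_mono[OF a]) auto
  then show ?thesis
    by (rule in_span_cong) (use \<open>a \<noteq> 0\<close> in \<open>simp add: field_simps\<close>)
qed

lemma monom_indep_coeffs:
  assumes "monom_indep D L" "finite L" "\<And>x. x \<in> D \<Longrightarrow> (\<Sum>\<alpha>\<in>L. c \<alpha> * monom x \<alpha>) = 0" "\<alpha> \<in> L"
  shows "c \<alpha> = 0"
proof (rule ccontr)
  assume nz: "c \<alpha> \<noteq> 0"
  have "in_span D (L - {\<alpha>}) (\<lambda>x. monom x \<alpha>)"
  proof (rule in_span_finite_sum)
    fix x assume "x \<in> D"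
    then have "c \<alpha> * monom x \<alpha> + (\<Sum>\<beta>\<in>L - {\<alpha>}. c \<beta> * monom x \<beta>) = 0"
      using assms by (simp add: sum.remove)
    then have "monom x \<alpha> = - (\<Sum>\<beta>\<in>L - {\<alpha>}. c \<beta> * monom x \<beta>) / c \<alpha>"
      using nz by (simp add: field_simps)
    then show "monom x \<alpha> = (\<Sum>\<beta>\<in>L - {\<alpha>}. (- c \<beta> / c \<alpha>) * monom x \<beta>)"
      by (simp add: sum_divide_distrib sum_negf)
  qed (use assms in auto)
  then show False
    using assms unfolding monom_indep_def by blast
qed

text \<open>Lagrange interpolation: a product of linear factors, one for each other point, is 1 at
  \<open>y\<close> and 0 on \<open>D - {y}\<close>, and these products combine to any
  \<open>f\<close>.\<close>

lemma in_span_UNIV: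
  assumes "finite D"
  shows "in_span D UNIV f"
proof -
  have ex: "\<exists>g. in_span D UNIV g \<and> g y = 1 \<and> (\<forall>z\<in>A. g z = 0)" if "finite A" "y \<notin> A" for y A
    using that
  proof (induction A rule: finite_induct)
    case empty
    have "in_span D UNIV (\<lambda>_. 1)"
      using in_span_monom[of "\<lambda>_. 0" UNIV D] by simp
    then show ?case by auto
  next
    case (insert z A)
    then obtain g where g: "in_span D UNIV g" "g y = 1" "\<forall>z\<in>A. g z = 0"
      by auto
    obtain i where i: "y $ i \<noteq> z $ i"
      using insert.prems by (metis insertI1 vec_eq_iff)
    \<comment> \<open>The new factor \<open>(x $ i - z $ i) / (y $ i - z $ i)\<close> is multiplied
      out so that the closure rules of \<open>in_span\<close> apply.\<close>
    define h where "h x = 1 / (y $ i - z $ i) * (g x * x $ i + (- z $ i) * g x)" for x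
    have "in_span D UNIV h"
      unfolding h_def
      using in_span_mult_monom[OF g(1), of "\<lambda>j. if j = i then 1 else 0"]
      by (intro in_span_add in_span_scale g) (simp add: monom_unit)
    moreover have "h y = 1" "\<forall>z\<in>insert z A. h z = 0"
      using g i by (auto simp: h_def)
    ultimately show ?case by blast
  qed
  have "\<forall>y. \<exists>g. in_span D UNIV g \<and> g y = 1 \<and> (\<forall>z\<in>D - {y}. g z = 0)"
    using ex assms by blast
  then obtain g where g: "\<And>y. in_span D UNIV (g y)" "\<And>y. g y y = 1"
      "\<And>y z. z \<in> D - {y} \<Longrightarrow> g y z = 0"
    by metis
  have "in_span D UNIV (\<lambda>x. \<Sum>y\<in>D. f y * g y x)"
    by (intro in_span_sum in_span_scale g)
  then show ?thesis
  proof (rule in_span_cong)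
    fix x assume "x \<in> D"
    have "(\<Sum>y\<in>D. f y * g y x) = (\<Sum>y\<in>D. if y = x then f y else 0)"
      by (rule sum.cong) (use g \<open>x \<in> D\<close> in auto)
    then show "(\<Sum>y\<in>D. f y * g y x) = f x"
      using assms \<open>x \<in> D\<close> by simp
  qed
qed

section \<open>Identifiable models as bases of the functions on the design\<close>

text \<open>The identity indexed by points writes \<open>f\<close> with coefficients
  \<open>B\<close> applied to \<open>f\<close>, which gives the span. The identity indexed by
  exponents makes row \<alpha> of \<open>B\<close> a functional that is 1 on the monomial \<alpha>
  and 0 on the others, which gives independence.\<close>

lemma identifiableD:
  assumes "finite D" "identifiable D L"
  shows "finite L" "card L = card D" "monom_indep D L" "in_span D L f"
proof -
  show fin: "finite L" and "card L = card D"
    using assms(2) unfolding identifiable_def by auto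
  obtain B where B: "\<And>x y. x \<in> D \<Longrightarrow> y \<in> D \<Longrightarrow> (\<Sum>\<alpha>\<in>L. monom x \<alpha> * B \<alpha> y) = (if x = y then 1 else 0)"
    "\<And>\<alpha> \<beta>. \<alpha> \<in> L \<Longrightarrow> \<beta> \<in> L \<Longrightarrow> (\<Sum>x\<in>D. B \<alpha> x * monom x \<beta>) = (if \<alpha> = \<beta> then 1 else 0)"
    using assms(2) unfolding identifiable_def by blast
  show "in_span D L f"
  proof (rule in_span_finite_sum[OF fin subset_refl])
    fix x assume "x \<in> D"
    have "(\<Sum>\<alpha>\<in>L. (\<Sum>y\<in>D. B \<alpha> y * f y) * monom x \<alpha>) = (\<Sum>\<alpha>\<in>L. \<Sum>y\<in>D. monom x \<alpha> * B \<alpha> y * f y)"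
      by (simp add: sum_distrib_left sum_distrib_right mult_ac)
    also have "\<dots> = (\<Sum>y\<in>D. (\<Sum>\<alpha>\<in>L. monom x \<alpha> * B \<alpha> y) * f y)"
      by (subst sum.swap) (simp add: sum_distrib_right)
    also have "\<dots> = (\<Sum>y\<in>D. if x = y then f y else 0)"
      by (rule sum.cong) (use B \<open>x \<in> D\<close> in auto)
    also have "\<dots> = f x"
      using \<open>x \<in> D\<close> assms(1) by simp
    finally show "f x = (\<Sum>\<alpha>\<in>L. (\<Sum>y\<in>D. B \<alpha> y * f y) * monom x \<alpha>)" by simp
  qed
  show "monom_indep D L"
    unfolding monom_indep_def
  proof (intro ballI notI)
    fix \<alpha> assume \<alpha>: "\<alpha> \<in> L" and "in_span D (L - {\<alpha>}) (\<lambda>x. monom x \<alpha>)"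
    then obtain c where c: "poly_supp c \<subseteq> L - {\<alpha>}" "\<forall>x\<in>D. monom x \<alpha> = mpoly_eval c x"
      unfolding in_span_def by blast
    have "1 = (\<Sum>x\<in>D. B \<alpha> x * monom x \<alpha>)"
      using B \<alpha> by simp
    also have "\<dots> = (\<Sum>x\<in>D. B \<alpha> x * (\<Sum>\<beta>\<in>poly_supp c. c \<beta> * monom x \<beta>))"
      using c by (intro sum.cong) (auto simp: mpoly_eval_def)
    also have "\<dots> = (\<Sum>x\<in>D. \<Sum>\<beta>\<in>poly_supp c. c \<beta> * (B \<alpha> x * monom x \<beta>))"
      by (simp add: sum_distrib_left mult_ac)
    also have "\<dots> = (\<Sum>\<beta>\<in>poly_supp c. c \<beta> * (\<Sum>x\<in>D. B \<alpha> x * monom x \<beta>))"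
      by (subst sum.swap) (simp add: sum_distrib_left)
    also have "\<dots> = 0"
    proof (rule sum.neutral, rule ballI)
      fix \<beta> assume "\<beta> \<in> poly_supp c"
      then have "\<beta> \<in> L" "\<alpha> \<noteq> \<beta>"
        using c(1) by auto
      then show "c \<beta> * (\<Sum>x\<in>D. B \<alpha> x * monom x \<beta>) = 0"
        using B(2)[OF \<alpha>] by simp
    qed
    finally show False by simp
  qed
qed

text \<open>The columns of the inverse are the coefficient vectors of interpolants of the point
  indicators; independence promotes this right inverse to a two-sided one.\<close>

lemma identifiableI:
  assumes "finite D" "finite L" "monom_indep D L" "\<And>f. in_span D L f"
  shows "identifiable D L"
proof -
  have "\<exists>c. \<forall>x\<in>D. (\<Sum>\<alpha>\<in>L. c \<alpha> * monom x \<alpha>) = (if x = y then 1 else 0)" for y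
  proof -
    obtain c where "poly_supp c \<subseteq> L" "\<forall>x\<in>D. (if x = y then 1 else 0) = mpoly_eval c x"
      using assms(4)[of "\<lambda>x. if x = y then 1 else 0"] unfolding in_span_def by blast
    then show ?thesis
      using mpoly_eval_superset[OF assms(2)] by (intro exI[of _ c]) auto
  qed
  then obtain c where c: "\<And>x y. x \<in> D \<Longrightarrow> (\<Sum>\<alpha>\<in>L. c y \<alpha> * monom x \<alpha>) = (if x = y then 1 else 0)"
    by metis
  define B where "B \<alpha> y = c y \<alpha>" for \<alpha> y
  have B1: "(\<Sum>\<alpha>\<in>L. monom x \<alpha> * B \<alpha> y) = (if x = y then 1 else 0)" if "x \<in> D" for x y
    using c[OF that, of y] by (simp add: B_def mult.commute)
  have B2: "(\<Sum>x\<in>D. B \<alpha> x * monom x \<beta>) = (if \<alpha> = \<beta> then 1 else 0)" if "\<alpha> \<in> L" "\<beta> \<in> L" for \<alpha> \<beta>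
  proof -
    \<comment> \<open>\<open>e\<close> is column \<beta> of \<open>B\<close> times the design
      matrix, minus the identity. The design matrix sends it to 0 because \<open>B\<close> is a
      right inverse, so independence makes it vanish.\<close>
    define e where "e \<alpha> = (\<Sum>x\<in>D. B \<alpha> x * monom x \<beta>) - (if \<alpha> = \<beta> then 1 else 0)" for \<alpha>
    have "(\<Sum>\<alpha>\<in>L. e \<alpha> * monom y \<alpha>) = 0" if "y \<in> D" for y
    proof -
      have "(\<Sum>\<alpha>\<in>L. (\<Sum>x\<in>D. B \<alpha> x * monom x \<beta>) * monom y \<alpha>)
          = (\<Sum>\<alpha>\<in>L. \<Sum>x\<in>D. (monom y \<alpha> * B \<alpha> x) * monom x \<beta>)"
        by (simp add: sum_distrib_left sum_distrib_right mult_ac)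
      also have "\<dots> = (\<Sum>x\<in>D. (\<Sum>\<alpha>\<in>L. monom y \<alpha> * B \<alpha> x) * monom x \<beta>)"
        by (subst sum.swap) (simp add: sum_distrib_right)
      also have "\<dots> = (\<Sum>x\<in>D. if y = x then monom x \<beta> else 0)"
        by (rule sum.cong) (use B1 that in auto)
      also have "\<dots> = monom y \<beta>"
        using that assms(1) by simp
      finally have 1: "(\<Sum>\<alpha>\<in>L. (\<Sum>x\<in>D. B \<alpha> x * monom x \<beta>) * monom y \<alpha>) = monom y \<beta>" .
      have "(\<Sum>\<alpha>\<in>L. (if \<alpha> = \<beta> then 1 else 0) * monom y \<alpha>) = (\<Sum>\<alpha>\<in>L. if \<alpha> = \<beta> then monom y \<alpha> else 0)"
        by (rule sum.cong) auto
      also have "\<dots> = monom y \<beta>"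
        using assms(2) \<open>\<beta> \<in> L\<close> by simp
      finally show ?thesis
        using 1 by (simp add: e_def left_diff_distrib sum_subtractf)
    qed
    from monom_indep_coeffs[OF assms(3,2) this \<open>\<alpha> \<in> L\<close>] show ?thesis
      by (simp add: e_def)
  qed
  \<comment> \<open>Both products of the matrix with its inverse have the same trace, so the matrix is square.\<close>
  have "real (card D) = (\<Sum>x\<in>D. \<Sum>\<alpha>\<in>L. monom x \<alpha> * B \<alpha> x)"
    using B1 by simp
  also have "\<dots> = (\<Sum>\<alpha>\<in>L. \<Sum>x\<in>D. B \<alpha> x * monom x \<alpha>)"
    by (subst sum.swap) (simp add: mult.commute)
  also have "\<dots> = real (card L)"
    using B2 by simp
  finally have "card L = card D" by simp
  then show ?thesis
    unfolding identifiable_def using assms(2) B1 B2 by blast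
qed

text \<open>Both basis properties come from \<open>in_span_exchange\<close>: one exchange recovers
  \<beta>, hence all of \<open>M\<close>; a second one turns a dependence in the new set into an
  expansion of \<alpha> over \<open>M - {\<beta>}\<close>.\<close>

lemma identifiable_exchange:
  assumes D: "finite D" and M: "identifiable D M" and \<beta>: "\<beta> \<in> M"
    and \<alpha>: "\<not> in_span D (M - {\<beta>}) (\<lambda>x. monom x \<alpha>)"
  shows "identifiable D (insert \<alpha> (M - {\<beta>}))"
proof (rule identifiableI[OF D])
  note M = identifiableD[OF D M]
  show "finite (insert \<alpha> (M - {\<beta>}))"
    using M(1) by simp
  have ins: "insert \<beta> (M - {\<beta>}) = M"
    using \<beta> by auto
  have sb: "in_span D (insert \<alpha> (M - {\<beta>})) (\<lambda>x. monom x \<beta>)"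
    by (rule in_span_exchange) (use ins M(4) \<alpha> in auto)
  show "in_span D (insert \<alpha> (M - {\<beta>})) f" for f
  proof (rule in_span_trans[OF M(4)])
    fix \<gamma> assume "\<gamma> \<in> M"
    then show "in_span D (insert \<alpha> (M - {\<beta>})) (\<lambda>x. monom x \<gamma>)"
      using sb by (cases "\<gamma> = \<beta>") (auto intro: in_span_monom)
  qed
  have \<alpha>M: "\<alpha> \<notin> M - {\<beta>}"
    using \<alpha> in_span_monom[of \<alpha> "M - {\<beta>}" D] by metis
  show "monom_indep D (insert \<alpha> (M - {\<beta>}))"
    unfolding monom_indep_def
  proof (intro ballI notI)
    fix \<gamma> assume \<gamma>: "\<gamma> \<in> insert \<alpha> (M - {\<beta>})"
      and sp: "in_span D (insert \<alpha> (M - {\<beta>}) - {\<gamma>}) (\<lambda>x. monom x \<gamma>)"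
    show False
    proof (cases "\<gamma> = \<alpha>")
      case True
      then have "insert \<alpha> (M - {\<beta>}) - {\<gamma>} = M - {\<beta>}"
        using \<alpha>M by auto
      then show False using sp \<alpha> True by simp
    next
      case False
      then have \<gamma>M: "\<gamma> \<in> M" "\<gamma> \<noteq> \<beta>" using \<gamma> by auto
      have eq: "insert \<alpha> (M - {\<beta>}) - {\<gamma>} = insert \<alpha> (M - {\<beta>} - {\<gamma>})"
        "insert \<gamma> (M - {\<beta>} - {\<gamma>}) = M - {\<beta>}"
        using False \<gamma>M by auto
      \<comment> \<open>Independence of \<open>M\<close> rules out an expansion of \<gamma> without
        \<alpha>, so the assumed one can be solved for \<alpha>.\<close>
      have "\<not> in_span D (M - {\<beta>} - {\<gamma>}) (\<lambda>x. monom x \<gamma>)"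
        using M(3) \<gamma>M in_span_mono[of D "M - {\<beta>} - {\<gamma>}" _ "M - {\<gamma>}"]
        unfolding monom_indep_def by blast
      from in_span_exchange[OF sp[unfolded eq(1)] this] show False
        using \<alpha> eq(2) by simp
    qed
  qed
qed

section \<open>Term orders\<close>

lemma term_orderD:
  assumes "term_order ord"
  shows "\<not> ord \<alpha> \<alpha>" "ord \<alpha> \<beta> \<Longrightarrow> ord \<beta> \<gamma> \<Longrightarrow> ord \<alpha> \<gamma>" "\<alpha> \<noteq> \<beta> \<Longrightarrow> ord \<alpha> \<beta> \<or> ord \<beta> \<alpha>"
    "\<alpha> \<noteq> (\<lambda>_. 0) \<Longrightarrow> ord (\<lambda>_. 0) \<alpha>" "ord \<alpha> \<beta> \<Longrightarrow> ord (\<lambda>i. \<alpha> i + \<gamma> i) (\<lambda>i. \<beta> i + \<gamma> i)"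
  using assms unfolding term_order_def by metis+

text \<open>The quotient \<delta> is 0 or lies above 0, and translation by \<alpha> preserves this:
  a term order extends divisibility.\<close>

lemma term_order_le:
  assumes "term_order ord" "\<And>i. \<alpha> i \<le> \<beta> i"
  shows "\<alpha> = \<beta> \<or> ord \<alpha> \<beta>"
proof -
  define \<delta> where "\<delta> = (\<lambda>i. \<beta> i - \<alpha> i)"
  have \<beta>: "\<beta> = (\<lambda>i. \<delta> i + \<alpha> i)"
    using assms(2) by (auto simp: \<delta>_def)
  show ?thesis
  proof (cases "\<delta> = (\<lambda>_. 0)")
    case True
    then show ?thesis using \<beta> by simp
  next
    case False
    then have "ord (\<lambda>i. 0 + \<alpha> i) (\<lambda>i. \<delta> i + \<alpha> i)"
      using term_orderD(4,5)[OF assms(1)] by blast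
    then show ?thesis using \<beta> by simp
  qed
qed

section \<open>Dickson's lemma and well-foundedness of term orders\<close>

text \<open>Some monotone subsequence exists. If it is decreasing, it attains its minimum at an
  index \<open>N\<close> and is constant from there on, so its tail is weakly increasing.\<close>

lemma nat_seq_incseq_subseq:
  fixes s :: "nat \<Rightarrow> nat"
  obtains r where "strict_mono r" "incseq (\<lambda>k. s (r k))"
proof -
  obtain q where q: "strict_mono q" "monoseq (\<lambda>n. s (q n))"
    using seq_monosub[of s] by blast
  show thesis
  proof (cases "incseq (\<lambda>n. s (q n))")
    case True
    with q that show thesis by blast
  next
    case False
    then have dec: "decseq (\<lambda>n. s (q n))"
      using q(2) by (auto simp: monoseq_iff)
    obtain N where N: "\<And>k. s (q N) \<le> s (q k)"
      using ex_has_least_nat[of "\<lambda>_. True" undefined "\<lambda>n. s (q n)"] by auto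
    have "s (q (k + N)) = s (q N)" for k
      using N[of "k + N"] decseqD[OF dec, of N "k + N"] by simp
    moreover have "strict_mono (\<lambda>k. q (k + N))"
      using q(1) by (simp add: strict_mono_def)
    ultimately show thesis
      using that[of "\<lambda>k. q (k + N)"] by (simp add: incseq_def)
  qed
qed

text \<open>Dickson's lemma for sequences: subsequences are refined one coordinate at a time, and a
  refinement keeps the earlier coordinates monotone.\<close>

lemma expo_seq_incseq_subseq:
  fixes f :: "nat \<Rightarrow> 'd \<Rightarrow> nat"
  assumes "finite I"
  shows "\<exists>r. strict_mono r \<and> (\<forall>i\<in>I. incseq (\<lambda>k. f (r k) i))"
  using assms
proof (induction I rule: finite_induct)
  case empty
  then show ?case by (auto intro!: exI[of _ id] simp: strict_mono_def)
next
  case (insert i I)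
  then obtain r where r: "strict_mono r" "\<forall>i\<in>I. incseq (\<lambda>k. f (r k) i)"
    by blast
  obtain q where q: "strict_mono q" "incseq (\<lambda>k. f (r (q k)) i)"
    by (rule nat_seq_incseq_subseq[of "\<lambda>k. f (r k) i"])
  have "incseq (\<lambda>k. f (r (q k)) j)" if "j \<in> I" for j
    using r(2) that q(1) unfolding incseq_def by (simp add: strict_mono_less_eq)
  moreover have "strict_mono (\<lambda>k. r (q k))"
    using r q by (simp add: strict_mono_def)
  ultimately show ?case
    using q by (intro exI[of _ "\<lambda>k. r (q k)"]) auto
qed

text \<open>In an infinite descent, Dickson's lemma finds an earlier exponent dividing a later one;
  by \<open>term_order_le\<close> the earlier one is then not larger, contrary to the
  descent.\<close>

lemma term_order_wf:
  fixes ord :: "('d::finite) expo \<Rightarrow> 'd expo \<Rightarrow> bool"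
  assumes "term_order ord"
  shows "wf {(\<alpha>, \<beta>). ord \<alpha> \<beta>}"
  unfolding wf_iff_no_infinite_down_chain
proof
  note to = term_orderD[OF assms]
  assume "\<exists>f. \<forall>k. (f (Suc k), f k) \<in> {(\<alpha>, \<beta>). ord \<alpha> \<beta>}"
  then obtain f where f: "\<And>k. ord (f (Suc k)) (f k)" by blast
  have desc: "ord (f n) (f m)" if "m < n" for m n
    using that by (induction n) (use f to(2) in \<open>auto simp: less_Suc_eq\<close>)
  obtain r where r: "strict_mono r" "\<And>i. incseq (\<lambda>k. f (r k) i)"
    using expo_seq_incseq_subseq[of UNIV f] by auto
  have "f (r 0) = f (r 1) \<or> ord (f (r 0)) (f (r 1))"
    by (rule term_order_le[OF assms]) (use r(2) in \<open>auto simp: incseq_def\<close>)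
  moreover have "ord (f (r 1)) (f (r 0))"
    using desc r(1) by (simp add: strict_mono_def)
  ultimately show False
    using to(1,2) by metis
qed

section \<open>Leading exponents, normal forms and the standard basis\<close>

text \<open>Justifies the definite description in \<open>lead_exp\<close>: totality and transitivity
  give a finite nonempty support a maximum, and irreflexivity with transitivity makes it
  unique.\<close>

lemma lead_exp_props:
  assumes "term_order ord" "is_mpoly c" "c \<noteq> (\<lambda>_. 0)"
  shows "lead_exp ord c \<in> poly_supp c"
    and "\<beta> \<in> poly_supp c \<Longrightarrow> \<beta> \<noteq> lead_exp ord c \<Longrightarrow> ord \<beta> (lead_exp ord c)"
proof -
  note to = term_orderD[OF assms(1)]
  have max: "\<exists>\<alpha>\<in>S. \<forall>\<beta>\<in>S. \<beta> \<noteq> \<alpha> \<longrightarrow> ord \<beta> \<alpha>" if "finite S" "S \<noteq> {}" for S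
    using that
  proof (induction S rule: finite_ne_induct)
    case (insert \<gamma> S)
    then obtain \<alpha> where \<alpha>: "\<alpha> \<in> S" "\<forall>\<beta>\<in>S. \<beta> \<noteq> \<alpha> \<longrightarrow> ord \<beta> \<alpha>" by blast
    then have "\<gamma> \<noteq> \<alpha>" using insert by auto
    then show ?case
      using \<alpha> to(2,3) by (metis insert_iff)
  qed simp
  have "poly_supp c \<noteq> {}"
    using assms(3) by (auto simp: poly_supp_def)
  then obtain \<alpha> where \<alpha>: "\<alpha> \<in> poly_supp c \<and> (\<forall>\<beta>\<in>poly_supp c. \<beta> \<noteq> \<alpha> \<longrightarrow> ord \<beta> \<alpha>)"
    using max assms(2) unfolding is_mpoly_def by blast
  have "lead_exp ord c \<in> poly_supp c \<and>
      (\<forall>\<beta>\<in>poly_supp c. \<beta> \<noteq> lead_exp ord c \<longrightarrow> ord \<beta> (lead_exp ord c))"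
    unfolding lead_exp_def by (rule theI[where P = "\<lambda>\<alpha>. \<alpha> \<in> poly_supp c \<and> (\<forall>\<beta>\<in>poly_supp c. \<beta> \<noteq> \<alpha> \<longrightarrow> ord \<beta> \<alpha>)", OF \<alpha>])
      (use \<alpha> to(1,2) in metis)
  then show "lead_exp ord c \<in> poly_supp c"
    and "\<beta> \<in> poly_supp c \<Longrightarrow> \<beta> \<noteq> lead_exp ord c \<Longrightarrow> ord \<beta> (lead_exp ord c)"
    by auto
qed

text \<open>The division algorithm as a well-founded induction. The bound by \<alpha> is carried
  along because it makes the later exchanges go downwards.\<close>

lemma std_basis_normal_form:
  assumes "term_order ord"
  shows "in_span D {\<beta> \<in> std_basis D ord. \<beta> = \<alpha> \<or> ord \<beta> \<alpha>} (\<lambda>x. monom x \<alpha>)"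
  using term_order_wf[OF assms]
proof (induction \<alpha> rule: wf_induct_rule)
  case (less \<alpha>)
  note to = term_orderD[OF assms]
  show ?case
  proof (cases "\<alpha> \<in> std_basis D ord")
    case True
    then show ?thesis by (intro in_span_monom) simp
  next
    case False
    then obtain c where c: "c \<in> design_ideal D" "c \<noteq> (\<lambda>_. 0)" "\<And>i. lead_exp ord c i \<le> \<alpha> i"
      unfolding std_basis_def by blast
    define \<gamma> where "\<gamma> = lead_exp ord c"
    define \<delta> where "\<delta> = (\<lambda>i. \<alpha> i - \<gamma> i)"
    have mp: "is_mpoly c" and zero: "\<And>x. x \<in> D \<Longrightarrow> mpoly_eval c x = 0"
      using c(1) unfolding design_ideal_def by auto
    have \<gamma>: "\<gamma> \<in> poly_supp c" "\<And>\<beta>. \<beta> \<in> poly_supp c \<Longrightarrow> \<beta> \<noteq> \<gamma> \<Longrightarrow> ord \<beta> \<gamma>"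
      unfolding \<gamma>_def using lead_exp_props[OF assms mp c(2)] by blast+
    have \<alpha>: "\<alpha> = (\<lambda>i. \<gamma> i + \<delta> i)"
      using c(3) by (auto simp: \<delta>_def \<gamma>_def)
    \<comment> \<open>On \<open>D\<close> the relation given by \<open>c\<close> is solved for its
      leading monomial and multiplied by the monomial of \<delta>; every exponent that results is
      smaller than \<alpha>.\<close>
    have "in_span D {\<beta> \<in> std_basis D ord. \<beta> = \<alpha> \<or> ord \<beta> \<alpha>}
       (\<lambda>x. \<Sum>\<beta>\<in>poly_supp c - {\<gamma>}. (- c \<beta> / c \<gamma>) * monom x (\<lambda>i. \<beta> i + \<delta> i))"
    proof (intro in_span_sum in_span_scale)
      fix \<beta> assume "\<beta> \<in> poly_supp c - {\<gamma>}"
      then have lt: "ord (\<lambda>i. \<beta> i + \<delta> i) \<alpha>"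
        unfolding \<alpha> using \<gamma> to(5) by simp
      then show "in_span D {\<beta> \<in> std_basis D ord. \<beta> = \<alpha> \<or> ord \<beta> \<alpha>} (\<lambda>x. monom x (\<lambda>i. \<beta> i + \<delta> i))"
        using to(2) by (intro in_span_mono[OF less.IH]) auto
    qed
    then show ?thesis
    proof (rule in_span_cong)
      fix x assume "x \<in> D"
      have nz: "c \<gamma> \<noteq> 0"
        using \<gamma>(1) by (simp add: poly_supp_def)
      have "c \<gamma> * monom x \<gamma> + (\<Sum>\<beta>\<in>poly_supp c - {\<gamma>}. c \<beta> * monom x \<beta>) = 0"
        using zero[OF \<open>x \<in> D\<close>] mp \<gamma>(1) by (simp add: mpoly_eval_def is_mpoly_def sum.remove)
      then have "monom x \<gamma> = - (\<Sum>\<beta>\<in>poly_supp c - {\<gamma>}. c \<beta> * monom x \<beta>) / c \<gamma>"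
        using nz by (simp add: field_simps)
      then have "monom x \<gamma> = (\<Sum>\<beta>\<in>poly_supp c - {\<gamma>}. (- c \<beta> / c \<gamma>) * monom x \<beta>)"
        by (simp add: sum_divide_distrib sum_negf)
      then have "monom x \<alpha> = (\<Sum>\<beta>\<in>poly_supp c - {\<gamma>}. (- c \<beta> / c \<gamma>) * monom x \<beta>) * monom x \<delta>"
        by (simp add: \<alpha> monom_add)
      then show "(\<Sum>\<beta>\<in>poly_supp c - {\<gamma>}. (- c \<beta> / c \<gamma>) * monom x (\<lambda>i. \<beta> i + \<delta> i)) = monom x \<alpha>"
        by (simp add: monom_add sum_distrib_right mult.assoc)
    qed
  qed
qed

text \<open>A dependence would be a nonzero element of the design ideal supported on standard
  exponents. Its leading exponent would then be standard and yet divisible by itself.\<close>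

lemma std_basis_indep:
  assumes "term_order ord"
  shows "monom_indep D (std_basis D ord)"
  unfolding monom_indep_def
proof (intro ballI notI)
  fix \<alpha> assume \<alpha>: "\<alpha> \<in> std_basis D ord"
    and "in_span D (std_basis D ord - {\<alpha>}) (\<lambda>x. monom x \<alpha>)"
  then obtain c where c: "is_mpoly c" "poly_supp c \<subseteq> std_basis D ord - {\<alpha>}"
    "\<forall>x\<in>D. monom x \<alpha> = mpoly_eval c x"
    unfolding in_span_def by blast
  \<comment> \<open>The dependence with all terms on one side; the coefficient -1 at \<alpha> keeps
    it nonzero.\<close>
  define e where "e = c(\<alpha> := -1)"
  have ca: "c \<alpha> = 0"
    using c(2) by (auto simp: poly_supp_def)
  have supp: "poly_supp e = insert \<alpha> (poly_supp c)"
    using ca by (auto simp: e_def poly_supp_def)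
  have mp: "is_mpoly e"
    using c(1) supp by (simp add: is_mpoly_def)
  have ne: "e \<noteq> (\<lambda>_. 0)"
    by (metis e_def fun_upd_same neg_equal_0_iff_equal one_neq_zero)
  have "mpoly_eval e x = 0" if "x \<in> D" for x
  proof -
    have "(\<Sum>\<beta>\<in>poly_supp c. e \<beta> * monom x \<beta>) = mpoly_eval c x"
      unfolding mpoly_eval_def by (rule sum.cong) (use c(2) in \<open>auto simp: e_def\<close>)
    moreover have "\<alpha> \<notin> poly_supp c" "finite (poly_supp c)"
      using c by (auto simp: is_mpoly_def)
    ultimately show ?thesis
      using c(3) that by (simp add: mpoly_eval_def[of e] supp) (simp add: e_def)
  qed
  then have "e \<in> design_ideal D"
    using mp by (simp add: design_ideal_def)
  moreover have "lead_exp ord e \<in> std_basis D ord"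
    using lead_exp_props(1)[OF assms mp ne] supp c(2) \<alpha> by auto
  ultimately show False
    unfolding std_basis_def using ne by blast
qed

text \<open>The delicate point is finiteness. Interpolants of the finitely many point indicators use
  a finite set \<open>L0\<close> of standard exponents; it already spans everything, so independence
  leaves no standard exponent outside it.\<close>

lemma std_basis_in_ident_staircases:
  assumes "finite D" "term_order ord"
  shows "std_basis D ord \<in> ident_staircases D"
proof -
  let ?L = "std_basis D ord"
  have "staircase ?L"
    unfolding staircase_def std_basis_def by (blast intro: order_trans)
  have span: "in_span D ?L f" for f
    by (rule in_span_trans[OF in_span_UNIV[OF assms(1)]],
        rule in_span_mono[OF std_basis_normal_form[OF assms(2)]]) auto
  have "\<exists>c. is_mpoly c \<and> poly_supp c \<subseteq> ?L \<and> (\<forall>x\<in>D. (if x = y then 1 else 0) = mpoly_eval c x)" for y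
    using span[of "\<lambda>x. if x = y then 1 else 0"] unfolding in_span_def .
  then obtain c where c: "\<And>y. is_mpoly (c y)" "\<And>y. poly_supp (c y) \<subseteq> ?L"
    "\<And>y x. x \<in> D \<Longrightarrow> (if x = y then 1 else 0) = mpoly_eval (c y) x"
    by metis
  define L0 where "L0 = (\<Union>y\<in>D. poly_supp (c y))"
  have fin: "finite L0" and sub: "L0 \<subseteq> ?L"
    using c assms(1) by (auto simp: L0_def is_mpoly_def)
  have L0: "in_span D L0 f" for f
  proof -
    have "in_span D L0 (\<lambda>x. if x = y then 1 else 0)" if "y \<in> D" for y
      unfolding in_span_def by (rule exI[of _ "c y"]) (use c that in \<open>auto simp: L0_def\<close>)
    then have "in_span D L0 (\<lambda>x. \<Sum>y\<in>D. f y * (if x = y then 1 else 0))"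
      by (intro in_span_sum in_span_scale)
    then show ?thesis
      by (rule in_span_cong) (use assms(1) in \<open>simp add: if_distrib cong: if_cong\<close>)
  qed
  note ind = std_basis_indep[OF assms(2), of D]
  have "?L \<subseteq> L0"
  proof
    fix \<alpha> assume "\<alpha> \<in> ?L"
    show "\<alpha> \<in> L0"
    proof (rule ccontr)
      assume "\<alpha> \<notin> L0"
      then have "in_span D (?L - {\<alpha>}) (\<lambda>x. monom x \<alpha>)"
        using sub by (intro in_span_mono[OF L0]) auto
      then show False
        using ind \<open>\<alpha> \<in> ?L\<close> unfolding monom_indep_def by blast
    qed
  qed
  then have "finite ?L"
    using fin by (rule finite_subset)
  then show ?thesis
    unfolding ident_staircases_def
    using identifiableI[OF assms(1) _ ind span] \<open>staircase ?L\<close> by blast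
qed

text \<open>Induction on the number of nonstandard exponents of \<open>M\<close>. Monotonicity is
  asked only for pairs that an exchange can meet: the condition passes to the new model, which gains
  only a standard exponent, and can be met by a weight controlled on a finite set.\<close>

lemma std_basis_minimal:
  fixes wt :: "'d::finite expo \<Rightarrow> real"
  assumes D: "finite D" and ord: "term_order ord" and "identifiable D M"
    and "\<And>\<alpha> \<beta>. \<alpha> \<in> std_basis D ord \<Longrightarrow> \<beta> \<in> M - std_basis D ord \<Longrightarrow> ord \<alpha> \<beta> \<Longrightarrow> wt \<alpha> \<le> wt \<beta>"
  shows "sum wt (std_basis D ord) \<le> sum wt M"
  using assms(3,4)
proof (induction "card (M - std_basis D ord)" arbitrary: M rule: less_induct)
  case less
  let ?L = "std_basis D ord"
  note M = identifiableD[OF D less.prems(1)]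
  have "identifiable D ?L"
    using std_basis_in_ident_staircases[OF D ord] by (simp add: ident_staircases_def)
  note L = identifiableD[OF D this]
  show ?case
  proof (cases "M \<subseteq> ?L")
    case True
    then have "M = ?L"
      using L(1,2) M(2) by (intro card_subset_eq) auto
    then show ?thesis by simp
  next
    case False
    then obtain \<beta> where \<beta>: "\<beta> \<in> M" "\<beta> \<notin> ?L" by blast
    have "\<not> in_span D (M - {\<beta>}) (\<lambda>x. monom x \<beta>)"
      using M(3) \<beta> unfolding monom_indep_def by blast
    \<comment> \<open>If the rest of \<open>M\<close> spanned every exponent in the normal form of
      \<beta>, it would span \<beta>. As \<beta> is not standard, the exponent found is strictly
      smaller.\<close>
    then obtain \<alpha> where \<alpha>: "\<alpha> \<in> ?L" "\<alpha> = \<beta> \<or> ord \<alpha> \<beta>" "\<not> in_span D (M - {\<beta>}) (\<lambda>x. monom x \<alpha>)"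
      using in_span_trans[OF std_basis_normal_form[OF ord, of D \<beta>], of "M - {\<beta>}"] by blast
    have lt: "ord \<alpha> \<beta>"
      using \<alpha>(1,2) \<beta> by auto
    have \<alpha>M: "\<alpha> \<notin> M - {\<beta>}"
      using \<alpha>(3) in_span_monom[of \<alpha> "M - {\<beta>}" D] by metis
    let ?M = "insert \<alpha> (M - {\<beta>})"
    have diff: "?M - ?L \<subset> M - ?L"
      using \<alpha>(1) \<beta> by auto
    have "sum wt ?L \<le> sum wt ?M"
    proof (rule less.hyps)
      show "card (?M - ?L) < card (M - ?L)"
        using M(1) diff by (intro psubset_card_mono) auto
      show "identifiable D ?M"
        using identifiable_exchange[OF D less.prems(1) \<beta>(1) \<alpha>(3)] .
      show "wt \<gamma> \<le> wt \<delta>" if "\<gamma> \<in> ?L" "\<delta> \<in> ?M - ?L" "ord \<gamma> \<delta>" for \<gamma> \<delta>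
        using less.prems(2) that diff by blast
    qed
    also have "\<dots> = wt \<alpha> + sum wt (M - {\<beta>})"
      using M(1) \<alpha>M by simp
    also have "\<dots> \<le> wt \<beta> + sum wt (M - {\<beta>})"
      using less.prems(2) \<alpha>(1) \<beta> lt by simp
    also have "\<dots> = sum wt M"
      using M(1) \<beta>(1) by (simp add: sum.remove)
    finally show ?thesis .
  qed
qed

text \<open>Lowering coordinate \<open>i\<close> of a member \<alpha> gives
  \<open>\<alpha> i + 1\<close> members of the staircase, so the size of the model bounds each
  coordinate and all models lie in one finite box.\<close>

lemma finite_ident_staircases: "finite (ident_staircases (D :: (real^'d) set))"
proof -
  let ?B = "PiE (UNIV :: 'd set) (\<lambda>_. {..card D})"
  have "L \<subseteq> ?B" if "L \<in> ident_staircases D" for L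
  proof
    fix \<alpha> assume \<alpha>: "\<alpha> \<in> L"
    have L: "finite L" "card L = card D" "staircase L"
      using that by (auto simp: ident_staircases_def identifiable_def)
    have "\<alpha> i \<le> card D" for i
    proof -
      have "(\<lambda>k. \<alpha>(i := k)) ` {..\<alpha> i} \<subseteq> L"
        using L(3) \<alpha> unfolding staircase_def by auto
      moreover have "inj_on (\<lambda>k. \<alpha>(i := k)) {..\<alpha> i}"
        by (rule inj_onI) (metis fun_upd_same)
      ultimately have "card {..\<alpha> i} \<le> card L"
        using L(1) by (metis card_image card_mono)
      then show ?thesis using L(2) by simp
    qed
    then show "\<alpha> \<in> ?B" by auto
  qed
  then have "ident_staircases D \<subseteq> Pow ?B" by blast
  then show ?thesis
    by (rule finite_subset) (simp add: finite_PiE)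
qed

section \<open>Weights and term orders\<close>

definition weight :: "real^'d \<Rightarrow> 'd expo \<Rightarrow> real" where
  "weight w \<alpha> = (\<Sum>i\<in>UNIV. w $ i * real (\<alpha> i))"

lemma weight_add: "weight w (\<lambda>i. \<alpha> i + \<beta> i) = weight w \<alpha> + weight w \<beta>"
  by (simp add: weight_def distrib_left sum.distrib)

text \<open>Links the exchange argument, which sums over exponents, with the linear functional that
  is minimised on the polytope.\<close>

lemma sum_weight: "sum (weight w) L = w \<bullet> alpha_bar L"
  unfolding weight_def alpha_bar_def inner_vec_def
  by (subst sum.swap) (simp add: sum_distrib_left)

lemma aberration_alt: "aberration w L = (1 / real (card L)) * (w \<bullet> alpha_bar L)"
  unfolding aberration_def sum_weight[symmetric] by (simp add: weight_def)

text \<open>The weight order of \<^term>\<open>w\<close> with ties broken lexicographically.\<close>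

lemma term_order_refining_weight:
  fixes w :: "real^'d"
  assumes "\<And>i. w $ i > 0"
  obtains ord where "term_order ord" "\<And>\<alpha> \<beta>. ord \<alpha> \<beta> \<Longrightarrow> weight w \<alpha> \<le> weight w \<beta>"
proof -
  \<comment> \<open>The index type carries no order, so an injection into the naturals ranks the
    coordinates for the tie-break.\<close>
  obtain h :: "'d \<Rightarrow> nat" where h: "inj h"
    using finite_imp_inj_to_nat_seg[of "UNIV :: 'd set"] by auto
  define lex where "lex \<alpha> \<beta> \<longleftrightarrow> (\<exists>i. \<alpha> i < \<beta> i \<and> (\<forall>j. h j < h i \<longrightarrow> \<alpha> j = \<beta> j))"
    for \<alpha> \<beta> :: "'d expo"
  define ord where "ord \<alpha> \<beta> \<longleftrightarrow> weight w \<alpha> < weight w \<beta> \<or> weight w \<alpha> = weight w \<beta> \<and> lex \<alpha> \<beta>"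
    for \<alpha> \<beta> :: "'d expo"
  have irr: "\<not> lex \<alpha> \<alpha>" for \<alpha>
    by (simp add: lex_def)
  have trans: "lex \<alpha> \<gamma>" if lt: "lex \<alpha> \<beta>" "lex \<beta> \<gamma>" for \<alpha> \<beta> \<gamma>
  proof -
    obtain i where i: "\<alpha> i < \<beta> i" "\<And>j. h j < h i \<Longrightarrow> \<alpha> j = \<beta> j"
      using lt(1) by (auto simp: lex_def)
    obtain k where k: "\<beta> k < \<gamma> k" "\<And>j. h j < h k \<Longrightarrow> \<beta> j = \<gamma> j"
      using lt(2) by (auto simp: lex_def)
    consider "h i < h k" | "i = k" | "h k < h i"
      using h by (metis injD linorder_neqE_nat)
    then show ?thesis
    proof cases
      case 1
      then show ?thesis using i k unfolding lex_def by (intro exI[of _ i]) auto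
    next
      case 2
      then show ?thesis using i k unfolding lex_def by (intro exI[of _ i]) auto
    next
      case 3
      then show ?thesis using i k unfolding lex_def by (intro exI[of _ k]) auto
    qed
  qed
  have total: "lex \<alpha> \<beta> \<or> lex \<beta> \<alpha>" if ne: "\<alpha> \<noteq> \<beta>" for \<alpha> \<beta>
  proof -
    obtain i0 where "\<alpha> i0 \<noteq> \<beta> i0"
      using ne by blast
    then obtain i where i: "\<alpha> i \<noteq> \<beta> i" "\<And>j. \<alpha> j \<noteq> \<beta> j \<Longrightarrow> h i \<le> h j"
      using ex_has_least_nat[of "\<lambda>i. \<alpha> i \<noteq> \<beta> i" i0 h] by blast
    then have "\<And>j. h j < h i \<Longrightarrow> \<alpha> j = \<beta> j"
      by (meson not_less)
    then show ?thesis
      using i(1) unfolding lex_def by (metis linorder_neqE_nat)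
  qed
  \<comment> \<open>Positivity of \<open>w\<close> makes 0 the least exponent by weight
    alone.\<close>
  have pos: "weight w (\<lambda>_. 0) < weight w \<alpha>" if "\<alpha> \<noteq> (\<lambda>_. 0)" for \<alpha>
  proof -
    obtain i where i: "\<alpha> i > 0"
      using \<open>\<alpha> \<noteq> (\<lambda>_. 0)\<close> by auto
    have "0 < (\<Sum>i\<in>UNIV. w $ i * real (\<alpha> i))"
      by (rule sum_pos2[of _ i]) (use i assms less_imp_le[OF assms] in auto)
    then show ?thesis by (simp add: weight_def)
  qed
  have "term_order ord"
    unfolding term_order_def
  proof (intro conjI allI impI)
    show "\<not> ord \<alpha> \<alpha>" for \<alpha>
      by (simp add: ord_def irr)
    show "ord \<alpha> \<gamma>" if "ord \<alpha> \<beta>" "ord \<beta> \<gamma>" for \<alpha> \<beta> \<gamma>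
      using that trans unfolding ord_def by (metis order_less_trans)
    show "ord \<alpha> \<beta> \<or> ord \<beta> \<alpha>" if "\<alpha> \<noteq> \<beta>" for \<alpha> \<beta>
      using total[OF that] unfolding ord_def by linarith
    show "ord (\<lambda>_. 0) \<alpha>" if "\<alpha> \<noteq> (\<lambda>_. 0)" for \<alpha>
      using pos[OF that] by (simp add: ord_def)
    show "ord (\<lambda>i. \<alpha> i + \<gamma> i) (\<lambda>i. \<beta> i + \<gamma> i)" if "ord \<alpha> \<beta>" for \<alpha> \<beta> \<gamma>
      using that by (auto simp: ord_def weight_add lex_def)
  qed
  moreover have "weight w \<alpha> \<le> weight w \<beta>" if "ord \<alpha> \<beta>" for \<alpha> \<beta>
    using that by (auto simp: ord_def)
  ultimately show thesis by (rule that)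
qed

section \<open>Positive weights representing a term order on a finite set\<close>

text \<open>Supplies the new coordinate in an elimination step. Either side may be empty, since the
  given vectors may lack entries of one sign.\<close>

lemma finite_separating_real:
  fixes A B :: "real set"
  assumes "finite A" "finite B" "\<And>a b. a \<in> A \<Longrightarrow> b \<in> B \<Longrightarrow> a < b"
  obtains t where "\<And>a. a \<in> A \<Longrightarrow> a < t" "\<And>b. b \<in> B \<Longrightarrow> t < b"
proof -
  consider "A = {}" "B = {}" | "A = {}" "B \<noteq> {}" | "A \<noteq> {}" "B = {}" | "A \<noteq> {}" "B \<noteq> {}"
    by blast
  then have "\<exists>t. (\<forall>a\<in>A. a < t) \<and> (\<forall>b\<in>B. t < b)"
  proof cases
    case 1
    then show ?thesis by simp
  next
    case 2
    then show ?thesis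
      using lt_ex[of "Min B"] assms by auto
  next
    case 3
    then show ?thesis
      using gt_ex[of "Max A"] assms by auto
  next
    case 4
    then have "Max A < Min B" using assms by simp
    then obtain t where "Max A < t" "t < Min B" using dense by blast
    then show ?thesis using 4 assms by auto
  qed
  then show thesis using that by blast
qed

text \<open>Fourier--Motzkin elimination, one coordinate per induction step. The eliminated vectors are
  positive integer combinations of the given ones, so closure of \<^term>\<open>P\<close> under addition suffices
  and no passage from real to rational coefficients is needed.\<close>

lemma additive_positive_functional:
  fixes P :: "('d \<Rightarrow> int) \<Rightarrow> bool"
  assumes add: "\<And>u v. P u \<Longrightarrow> P v \<Longrightarrow> P (\<lambda>i. u i + v i)" and nz: "\<not> P (\<lambda>_. 0)"
    and "finite I" "finite V" "\<And>v. v \<in> V \<Longrightarrow> P v" "\<And>v i. v \<in> V \<Longrightarrow> i \<notin> I \<Longrightarrow> v i = 0"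
  shows "\<exists>w :: 'd \<Rightarrow> real. \<forall>v\<in>V. (\<Sum>i\<in>I. w i * real_of_int (v i)) > 0"
  using assms(3-)
proof (induction I arbitrary: V rule: finite_induct)
  case empty
  \<comment> \<open>With no coordinates left, every member of \<open>V\<close> is 0, which
    \<open>nz\<close> excludes; so \<open>V\<close> is empty.\<close>
  then have "v = (\<lambda>_. 0)" if "v \<in> V" for v
    using that by auto
  then show ?case
    using empty(2) nz by metis
next
  case (insert k I)
  \<comment> \<open>Only positive multiples are available, hence \<open>Suc n\<close>: the multiple
    0 is the vector excluded from \<open>P\<close>.\<close>
  have scale: "P (\<lambda>i. int (Suc n) * v i)" if "P v" for n v
    using that
  proof (induction n)
    case (Suc n)
    have "P (\<lambda>i. int (Suc n) * v i + v i)"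
      using add[OF Suc.IH[OF Suc.prems] Suc.prems] .
    then show ?case by (simp add: algebra_simps)
  qed simp
  have scale': "P (\<lambda>i. a * v i)" if "P v" "a > 0" for a v
    using scale[OF that(1), of "nat a - 1"] that(2) by simp
  define Vp where "Vp = {v \<in> V. v k > 0}"
  define Vn where "Vn = {v \<in> V. v k < 0}"
  \<comment> \<open>For a pair in \<open>Vp \<times> Vn\<close> both multipliers are positive, and
    coordinate \<open>k\<close> cancels.\<close>
  define comb where "comb p i = fst p k * snd p i + (- snd p k) * fst p i" for p :: "('d \<Rightarrow> int) \<times> ('d \<Rightarrow> int)" and i
  define V' where "V' = {v \<in> V. v k = 0} \<union> comb ` (Vp \<times> Vn)"
  have "\<exists>w :: 'd \<Rightarrow> real. \<forall>v\<in>V'. (\<Sum>i\<in>I. w i * real_of_int (v i)) > 0"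
  proof (rule insert.IH)
    show "finite V'"
      using insert.prems(1) by (simp add: V'_def Vp_def Vn_def)
    show "P v" if v: "v \<in> V'" for v
    proof (cases "v \<in> V")
      case True
      then show ?thesis using insert.prems(2) by blast
    next
      case False
      then obtain p q where pq: "v = comb (p, q)" "p \<in> Vp" "q \<in> Vn"
        using v by (auto simp: V'_def)
      have "P (\<lambda>i. p k * q i)" "P (\<lambda>i. (- q k) * p i)"
        by (rule scale'; use pq insert.prems(2) in \<open>auto simp: Vp_def Vn_def\<close>)+
      from add[OF this] show ?thesis
        unfolding pq(1) comb_def by simp
    qed
    show "v i = 0" if "v \<in> V'" "i \<notin> I" for v i
    proof (cases "i = k")
      case True
      then show ?thesis
        using that(1) by (auto simp: V'_def comb_def)
    next
      case False
      then have zero: "u i = 0" if "u \<in> V" for u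
        using insert.prems(3)[OF that] \<open>i \<notin> I\<close> by simp
      then have "comb (p, q) i = 0" if "p \<in> V" "q \<in> V" for p q
        using zero[OF that(1)] zero[OF that(2)] by (simp add: comb_def)
      then show ?thesis
        using that(1) zero by (auto simp: V'_def Vp_def Vn_def)
    qed
  qed
  then obtain w :: "'d \<Rightarrow> real" where w: "\<And>v. v \<in> V' \<Longrightarrow> (\<Sum>i\<in>I. w i * real_of_int (v i)) > 0"
    by blast
  define S where "S v = (\<Sum>i\<in>I. w i * real_of_int (v i))" for v :: "'d \<Rightarrow> int"
  \<comment> \<open>As weight of coordinate \<open>k\<close>, the number \<open>t\<close> must
    exceed the left side for each \<open>p\<close> and stay below the right side for each
    \<open>q\<close>. Positivity on \<open>comb (p, q)\<close> says that these bounds are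
    compatible.\<close>
  have lt: "- S p / p k < S q / (- q k)" if "p \<in> Vp" "q \<in> Vn" for p q
  proof -
    have "S (comb (p, q)) = p k * S q + (- q k) * S p"
      unfolding S_def comb_def
      by (simp add: sum.distrib sum_distrib_left sum_negf algebra_simps sum_subtractf)
    moreover have "S (comb (p, q)) > 0"
      unfolding S_def by (rule w) (use that in \<open>auto simp: V'_def\<close>)
    moreover have "p k > 0" "q k < 0"
      using that by (auto simp: Vp_def Vn_def)
    ultimately show ?thesis
      by (simp add: field_simps)
  qed
  have fin: "finite ((\<lambda>p. - S p / p k) ` Vp)" "finite ((\<lambda>q. S q / (- q k)) ` Vn)"
    using insert.prems(1) by (auto simp: Vp_def Vn_def)
  obtain t where "\<And>a. a \<in> (\<lambda>p. - S p / p k) ` Vp \<Longrightarrow> a < t" "\<And>b. b \<in> (\<lambda>q. S q / (- q k)) ` Vn \<Longrightarrow> t < b"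
    using finite_separating_real[OF fin] lt by blast
  then have t: "\<And>p. p \<in> Vp \<Longrightarrow> - S p / p k < t" "\<And>q. q \<in> Vn \<Longrightarrow> t < S q / (- q k)"
    by blast+
  have "(\<Sum>i\<in>insert k I. (w(k := t)) i * real_of_int (v i)) > 0" if v: "v \<in> V" for v
  proof -
    have "(\<Sum>i\<in>I. (w(k := t)) i * real_of_int (v i)) = S v"
      unfolding S_def by (rule sum.cong) (use insert.hyps in auto)
    then have eq: "(\<Sum>i\<in>insert k I. (w(k := t)) i * real_of_int (v i)) = t * v k + S v"
      using insert.hyps by simp
    consider "v k = 0" | "v k > 0" | "v k < 0" by linarith
    then show ?thesis
    proof cases
      case 1
      then show ?thesis unfolding eq using w[of v] v by (simp add: S_def V'_def)
    next
      case 2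
      then show ?thesis unfolding eq using t(1)[of v] v by (simp add: Vp_def field_simps)
    next
      case 3
      then show ?thesis unfolding eq using t(2)[of v] v by (simp add: Vn_def field_simps)
    qed
  qed
  then show ?case by blast
qed

text \<open>\<open>additive_positive_functional\<close> applies to the differences of ordered pairs:
  translation and transitivity close them under addition, and irreflexivity excludes 0.\<close>

lemma positive_weight_on_finite:
  fixes ord :: "('d::finite) expo \<Rightarrow> 'd expo \<Rightarrow> bool"
  assumes "term_order ord" "finite E"
  obtains w :: "real^'d" where "\<And>i. w $ i > 0"
    "\<And>\<alpha> \<beta>. \<alpha> \<in> E \<Longrightarrow> \<beta> \<in> E \<Longrightarrow> ord \<alpha> \<beta> \<Longrightarrow> weight w \<alpha> < weight w \<beta>"
proof -
  note to = term_orderD[OF assms(1)]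
  define dif :: "'d expo \<Rightarrow> 'd expo \<Rightarrow> 'd \<Rightarrow> int" where "dif \<alpha> \<beta> = (\<lambda>i. int (\<beta> i) - int (\<alpha> i))" for \<alpha> \<beta>
  define unit :: "'d \<Rightarrow> 'd expo" where "unit i = (\<lambda>j. if j = i then 1 else 0)" for i
  define P where "P v \<longleftrightarrow> (\<exists>\<alpha> \<beta>. v = dif \<alpha> \<beta> \<and> ord \<alpha> \<beta>)" for v
  \<comment> \<open>The differences of unit exponents and 0 are included to force every coordinate
    of the weight to be positive.\<close>
  define V where "V = (\<lambda>(\<alpha>, \<beta>). dif \<alpha> \<beta>) ` {p \<in> E \<times> E. ord (fst p) (snd p)} \<union> range (\<lambda>i. dif (\<lambda>_. 0) (unit i))"
  have "\<exists>w :: 'd \<Rightarrow> real. \<forall>v\<in>V. (\<Sum>i\<in>UNIV. w i * real_of_int (v i)) > 0"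
  proof (rule additive_positive_functional)
    show "P (\<lambda>i. u i + v i)" if uv: "P u" "P v" for u v
    proof -
      obtain \<alpha> \<beta> \<gamma> \<delta> where *: "u = dif \<alpha> \<beta>" "ord \<alpha> \<beta>" "v = dif \<gamma> \<delta>" "ord \<gamma> \<delta>"
        using uv unfolding P_def by blast
      have "ord (\<lambda>i. \<alpha> i + \<gamma> i) (\<lambda>i. \<beta> i + \<gamma> i)" "ord (\<lambda>i. \<gamma> i + \<beta> i) (\<lambda>i. \<delta> i + \<beta> i)"
        using to(5) * by blast+
      then have "ord (\<lambda>i. \<alpha> i + \<gamma> i) (\<lambda>i. \<beta> i + \<delta> i)"
        using to(2) by (simp add: add.commute)
      moreover have "(\<lambda>i. u i + v i) = dif (\<lambda>i. \<alpha> i + \<gamma> i) (\<lambda>i. \<beta> i + \<delta> i)"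
        by (auto simp: * dif_def)
      ultimately show ?thesis unfolding P_def by blast
    qed
    show "\<not> P (\<lambda>_. 0)"
    proof
      assume "P (\<lambda>_. 0)"
      then obtain \<alpha> \<beta> where "dif \<alpha> \<beta> = (\<lambda>_. 0)" "ord \<alpha> \<beta>"
        unfolding P_def by metis
      then have "\<alpha> = \<beta>" "ord \<alpha> \<beta>"
        by (auto simp: dif_def fun_eq_iff)
      then show False using to(1) by blast
    qed
    have "unit i \<noteq> (\<lambda>_. 0)" for i
      by (metis unit_def one_neq_zero)
    then show "P v" if "v \<in> V" for v
      using that to(4) unfolding P_def V_def by fastforce
    show "finite V"
      using assms(2) by (auto simp: V_def)
  qed auto
  then obtain w :: "'d \<Rightarrow> real" where w: "\<And>v. v \<in> V \<Longrightarrow> (\<Sum>i\<in>UNIV. w i * real_of_int (v i)) > 0"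
    by blast
  have dif: "(\<Sum>i\<in>UNIV. w i * real_of_int (dif \<alpha> \<beta> i)) = weight (vec_lambda w) \<beta> - weight (vec_lambda w) \<alpha>" for \<alpha> \<beta>
    by (simp add: dif_def weight_def right_diff_distrib sum_subtractf)
  show thesis
  proof (rule that)
    show "weight (vec_lambda w) \<alpha> < weight (vec_lambda w) \<beta>" if "\<alpha> \<in> E" "\<beta> \<in> E" "ord \<alpha> \<beta>" for \<alpha> \<beta>
      using w[of "dif \<alpha> \<beta>"] that unfolding dif V_def by force
    fix i
    have "weight (vec_lambda w) (unit i) = (\<Sum>j\<in>UNIV. if j = i then w j else 0)"
      unfolding weight_def by (rule sum.cong) (auto simp: unit_def)
    moreover have "weight (vec_lambda w) (\<lambda>_. 0) = 0"
      by (simp add: weight_def)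
    ultimately show "vec_lambda w $ i > 0"
      using w[of "dif (\<lambda>_. 0) (unit i)"] unfolding dif V_def by simp
  qed
qed

section \<open>The state polytope\<close>

lemma algebraic_fan_subset: "finite D \<Longrightarrow> algebraic_fan D \<subseteq> ident_staircases D"
  unfolding algebraic_fan_def using std_basis_in_ident_staircases by blast

text \<open>The minimisers of the functional form a nonempty compact face of the hull. An extreme
  point of this face is one of the whole hull, and extreme points of a hull lie in the generating
  set.\<close>

lemma extreme_point_minimising:
  fixes S :: "'a::euclidean_space set"
  assumes "finite S" "p \<in> S" "\<And>x. x \<in> S \<Longrightarrow> w \<bullet> p \<le> w \<bullet> x"
  obtains v where "v extreme_point_of convex hull S" "v \<in> S" "w \<bullet> v = w \<bullet> p"
proof -
  let ?H = "convex hull S"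
  have ge: "w \<bullet> x \<ge> w \<bullet> p" if "x \<in> ?H" for x
  proof -
    have "?H \<subseteq> {x. w \<bullet> x \<ge> w \<bullet> p}"
      using assms(3) by (intro hull_minimal convex_halfspace_ge) auto
    then show ?thesis using that by blast
  qed
  let ?F = "?H \<inter> {x. w \<bullet> x = w \<bullet> p}"
  have face: "?F face_of ?H"
    by (rule face_of_Int_supporting_hyperplane_ge) (use ge in auto)
  have "compact ?F" "convex ?F" "?F \<noteq> {}"
    using assms by (auto intro!: compact_Int_closed finite_imp_compact_convex_hull closed_hyperplane
        convex_Int convex_hyperplane hull_inc)
  then obtain v where v: "v extreme_point_of ?F"
    using extreme_point_exists_convex by blast
  then have "v extreme_point_of ?H" "v \<in> ?F"
    using extreme_point_of_face[OF face] by auto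
  then show thesis
    using that extreme_point_of_convex_hull[of v S] by blast
qed

theorem theorem3:
  fixes D :: "(real^'d) set" and w :: "real^'d"
  assumes "finite D"
    and "\<forall>i. w $ i > 0"
  shows "(\<exists>\<alpha>s. \<alpha>s extreme_point_of state_polytope D \<and>
            (\<exists>L\<in>algebraic_fan D. alpha_bar L = \<alpha>s) \<and>
            (\<forall>Ls\<in>ident_staircases D. alpha_bar Ls = \<alpha>s \<longrightarrow>
               (1 / real (card D)) * (w \<bullet> \<alpha>s) = aberration w Ls \<and>
               (\<forall>L\<in>ident_staircases D. aberration w Ls \<le> aberration w L)))
       \<and> (\<forall>Lb\<in>algebraic_fan D. alpha_bar Lb extreme_point_of state_polytope D \<longrightarrow>
            (\<exists>ws :: real^'d. (\<forall>i. ws $ i > 0) \<and>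
               (\<forall>L\<in>algebraic_fan D. aberration ws Lb \<le> aberration ws L)))"
proof (intro conjI ballI impI)
  have fan_fin: "finite (algebraic_fan D)"
    using finite_subset[OF algebraic_fan_subset[OF assms(1)] finite_ident_staircases] .
  \<comment> \<open>All identifiable models have \<open>card D\<close> elements, so the aberration
    is the same multiple of the linear functional for each of them.\<close>
  have ab: "aberration u L = (1 / real (card D)) * (u \<bullet> alpha_bar L)" if "L \<in> ident_staircases D" for u L
    using that by (simp add: aberration_alt ident_staircases_def identifiable_def)
  obtain ord where ord: "term_order ord" "\<And>\<alpha> \<beta>. ord \<alpha> \<beta> \<Longrightarrow> weight w \<alpha> \<le> weight w \<beta>"
    using term_order_refining_weight[of w] assms(2) by blast
  define L0 where "L0 = std_basis D ord"
  have L0: "L0 \<in> algebraic_fan D"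
    unfolding L0_def algebraic_fan_def using ord(1) by blast
  \<comment> \<open>The comparison covers all identifiable staircases, not only the fan; this
    carries the minimum on the polytope over to them.\<close>
  have L0_min: "w \<bullet> alpha_bar L0 \<le> w \<bullet> alpha_bar L" if "L \<in> ident_staircases D" for L
    unfolding sum_weight[symmetric] L0_def
    by (rule std_basis_minimal[OF assms(1) ord(1)])
      (use that ord(2) in \<open>auto simp: ident_staircases_def\<close>)
  \<comment> \<open>\<open>alpha_bar L0\<close> itself may fail to be a vertex; \<open>v\<close> is
    a vertex with the same value under \<open>w\<close>.\<close>
  obtain v where v: "v extreme_point_of state_polytope D" "v \<in> alpha_bar ` algebraic_fan D"
      "w \<bullet> v = w \<bullet> alpha_bar L0"
    unfolding state_polytope_def
    using extreme_point_minimising[of "alpha_bar ` algebraic_fan D" "alpha_bar L0" w]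
      fan_fin L0 L0_min algebraic_fan_subset[OF assms(1)] by blast
  show "\<exists>\<alpha>s. \<alpha>s extreme_point_of state_polytope D \<and>
            (\<exists>L\<in>algebraic_fan D. alpha_bar L = \<alpha>s) \<and>
            (\<forall>Ls\<in>ident_staircases D. alpha_bar Ls = \<alpha>s \<longrightarrow>
               (1 / real (card D)) * (w \<bullet> \<alpha>s) = aberration w Ls \<and>
               (\<forall>L\<in>ident_staircases D. aberration w Ls \<le> aberration w L))"
  proof (intro exI[of _ v] conjI ballI impI v(1))
    show "\<exists>L\<in>algebraic_fan D. alpha_bar L = v"
      using v(2) by blast
    fix Ls assume Ls: "Ls \<in> ident_staircases D" "alpha_bar Ls = v"
    then show "(1 / real (card D)) * (w \<bullet> v) = aberration w Ls"
      by (simp add: ab)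
    fix L assume "L \<in> ident_staircases D"
    then show "aberration w Ls \<le> aberration w L"
      using L0_min[of L] Ls v(3) by (simp add: ab divide_right_mono)
  qed

  fix Lb assume "Lb \<in> algebraic_fan D"
  then obtain ordb where ordb: "term_order ordb" "Lb = std_basis D ordb"
    unfolding algebraic_fan_def by blast
  \<comment> \<open>The weight has to respect \<open>ordb\<close> only on exponents of identifiable
    staircases, and these are finitely many.\<close>
  have "finite (\<Union>(ident_staircases D))"
    by (rule finite_Union[OF finite_ident_staircases])
      (auto simp: ident_staircases_def identifiable_def)
  then obtain ws :: "real^'d" where ws: "\<And>i. ws $ i > 0"
    "\<And>\<alpha> \<beta>. \<alpha> \<in> \<Union>(ident_staircases D) \<Longrightarrow> \<beta> \<in> \<Union>(ident_staircases D) \<Longrightarrow> ordb \<alpha> \<beta> \<Longrightarrow>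
      weight ws \<alpha> < weight ws \<beta>"
    using positive_weight_on_finite[OF ordb(1)] by metis
  have Lb: "Lb \<in> ident_staircases D"
    unfolding ordb(2) by (rule std_basis_in_ident_staircases[OF assms(1) ordb(1)])
  have "aberration ws Lb \<le> aberration ws L" if "L \<in> algebraic_fan D" for L
  proof -
    have L: "L \<in> ident_staircases D"
      using that algebraic_fan_subset[OF assms(1)] by blast
    have "sum (weight ws) Lb \<le> sum (weight ws) L"
      unfolding ordb(2)
    proof (rule std_basis_minimal[OF assms(1) ordb(1)])
      show "identifiable D L"
        using L by (simp add: ident_staircases_def)
      show "weight ws \<alpha> \<le> weight ws \<beta>"
        if "\<alpha> \<in> std_basis D ordb" "\<beta> \<in> L - std_basis D ordb" "ordb \<alpha> \<beta>" for \<alpha> \<beta>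
        using ws(2)[of \<alpha> \<beta>] that L Lb ordb(2) by force
    qed
    then show ?thesis
      using L Lb by (simp add: ab sum_weight divide_right_mono)
  qed
  then show "\<exists>ws :: real^'d. (\<forall>i. ws $ i > 0) \<and>
               (\<forall>L\<in>algebraic_fan D. aberration ws Lb \<le> aberration ws L)"
    using ws(1) by blast
qed

end
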